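(* For every odd integer $n$ with $3\le n\le 27$, $$\{1\le k\le n-1: f_{\mathrm{inv}}\text{ on }\mathbb F_{2^n}\text{ is }k\text{th order sum-free}\}=\{1,2,n-2,n-1\}.$$
   Context: The multiplicative inverse function $f_{\mathrm{inv}}:\mathbb F_{2^n}\to\mathbb F_{2^n}$ is defined by $f_{\mathrm{inv}}(x)=x^{-1}$ for $x\ne 0$ and $f_{\mathrm{inv}}(0)=0$. A function $f:\mathbb F_{2^n}\to\mathbb F_{2^n}$ is $k$th order sum-free if $\sum_{x\in A}f(x)\ne 0$ for every $k$-dimensional $\mathbb F_2$-affine subspace $A$ of $\mathbb F_{2^n}$. *)

theory Defs
  imports Complex_Main "HOL-Library.Z2" "HOL-Library.Cardinality"
begin

(* The field with 2^n elements is any type of classes field and finite with 2^n elements.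
   The two-element field is the type bit. *)

definition f_inv :: "'a::field \<Rightarrow> 'a" where
  "f_inv x = (if x = 0 then 0 else inverse x)"

definition f2_scale :: "bit \<Rightarrow> 'a::field \<Rightarrow> 'a" where
  "f2_scale c x = (if c = 0 then 0 else x)"

lemma CARD_power2_imp_char2:
  assumes "CARD('a::{field,finite}) = 2 ^ n"
  shows "(1::'a) + 1 = 0"
proof -
  have "(\<Sum>x\<in>UNIV. x + 1) = (\<Sum>x\<in>UNIV. (x::'a))"
    by (rule sum.reindex_bij_witness[of _ "\<lambda>x. x - 1" "\<lambda>x. x + 1"]) auto
  then have "of_nat CARD('a) = (0::'a)"
    by (simp add: sum.distrib)
  then have "(2::'a) ^ n = 0"
    using assms by simp
  then show ?thesis by simp
qed

(* f2_scale is a vector space structure only in characteristic 2; this lemma makes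
   module.subspace and vector_space.dim below meaningful. *)
lemma vector_space_f2_scale:
  assumes "CARD('a::{field,finite}) = 2 ^ n"
  shows "vector_space (f2_scale :: bit \<Rightarrow> 'a \<Rightarrow> 'a)"
proof
  have double: "x + x = 0" for x :: 'a
    using CARD_power2_imp_char2[OF assms] by (metis distrib_left mult.right_neutral mult_zero_right)
  fix a b :: bit and x y :: 'a
  show "f2_scale a (x + y) = f2_scale a x + f2_scale a y"
    by (simp add: f2_scale_def)
  show "f2_scale (a + b) x = f2_scale a x + f2_scale b x"
    by (cases a; cases b) (simp_all add: f2_scale_def double)
  show "f2_scale a (f2_scale b x) = f2_scale (a * b) x"
    by (simp add: f2_scale_def)
  show "f2_scale 1 x = x"
    by (simp add: f2_scale_def)
qed

definition affine_subspace_of_dim :: "nat \<Rightarrow> 'a::field set \<Rightarrow> bool" where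
  "affine_subspace_of_dim k A \<longleftrightarrow>
     (\<exists>a V. module.subspace f2_scale V \<and> vector_space.dim f2_scale V = k \<and> A = (\<lambda>v. a + v) ` V)"

definition sum_free_of_order :: "nat \<Rightarrow> ('a::{field,finite} \<Rightarrow> 'a) \<Rightarrow> bool" where
  "sum_free_of_order k f \<longleftrightarrow> (\<forall>A. affine_subspace_of_dim k A \<longrightarrow> (\<Sum>x\<in>A. f x) \<noteq> 0)"

end

theory Submission
  imports Defs "HOL-Computational_Algebra.Polynomial"
begin

text \<open>
Write \<open>s(V)\<close> for the sum of the inverses of the nonzero elements of a binary subspace \<open>V\<close> of the
field \<open>F\<close> with \<open>2 ^ n\<close> elements, \<open>a(V)\<close> for their product, and \<open>L\<^sub>V(y)\<close> for the product of all
\<open>y + u\<close> with \<open>u \<in> V\<close>. The map \<open>L\<^sub>V\<close> is additive with kernel \<open>V\<close>, and its derivative is the constant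
\<open>a(V)\<close>. So, taking the logarithmic derivative, the inverses over a coset \<open>y + V\<close> that misses \<open>0\<close>
sum to \<open>a(V) / L\<^sub>V(y)\<close> (\<open>coset_recip_sum\<close>). This is never zero, so sum-freedom only depends on the
linear subspaces, that is, on whether some \<open>V\<close> of dimension \<open>k\<close> has \<open>s(V) = 0\<close>
(\<open>sum_free_f_inv_iff\<close>).

Adding up the coset sums gives, for \<open>W \<subseteq> V\<close>, the quotient formula
\<open>s(V) = s(W) + a(W) s(L\<^sub>W(V))\<close> (\<open>recip_sum_quotient\<close>), on which everything else rests.

\<^item> For \<open>V = F\<close>, where \<open>s(F) = 0\<close>, it says that \<open>s(W) = 0\<close> if and only if \<open>s(L\<^sub>W(F)) = 0\<close>, and
  \<open>L\<^sub>W(F)\<close> has dimension \<open>n - dim W\<close>. So \<open>k\<close> and \<open>n - k\<close> behave alike (\<open>dual_subspace\<close>).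
\<^item> For a line \<open>W\<close> in a plane \<open>V\<close>, it turns \<open>s(V) = 0\<close> into the existence of a primitive cube root
  of unity, which \<open>F\<close> lacks when \<open>n\<close> is odd (\<open>recip_sum_plane_nonzero\<close>). This settles \<open>k = 2\<close>, \<open>k = 1\<close>
  is trivial, and \<open>n - 2\<close> and \<open>n - 1\<close> follow by duality.
\<^item> For a line \<open>W\<close> in any \<open>V\<close>, it is a recursion on a basis which computes \<open>s(V)\<close> with about
  \<open>k\<^sup>2 / 2\<close> multiplications (\<open>recip_frac_subset_sums\<close>).

By duality it remains to find a subspace with \<open>s(V) = 0\<close> for each \<open>k\<close> with \<open>3 \<le> k < n / 2\<close>. These are
given explicitly. A subspace is spanned by polynomials in a root \<open>\<alpha>\<close> of a fixed binary polynomial \<open>p\<close>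
of degree \<open>n\<close>; such a root exists in every field with \<open>2 ^ n\<close> elements once \<open>p\<close> divides
\<open>X ^ (2 ^ n) - X\<close> (\<open>splits_root\<close>). Both this divisibility and \<open>s(V) = 0\<close> become computations with
binary polynomials modulo \<open>p\<close>, which rewriting on lists of bits carries out
(\<open>certified_subspace\<close>).
\<close>

section \<open>Binary subspaces\<close>

definition binary_subspace :: "'a::field set \<Rightarrow> bool" where
  "binary_subspace V \<longleftrightarrow> 0 \<in> V \<and> (\<forall>x\<in>V. \<forall>y\<in>V. x + y \<in> V)"

definition recip_sum :: "'a::field set \<Rightarrow> 'a" where
  "recip_sum V = (\<Sum>u\<in>V. inverse u)"

text \<open>
The subspace polynomial \<open>L\<^sub>V\<close>, as a function.
\<close>

definition vanishing :: "'a::field set \<Rightarrow> 'a \<Rightarrow> 'a" where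
  "vanishing V y = (\<Prod>u\<in>V. y + u)"

definition nonzero_prod :: "'a::field set \<Rightarrow> 'a" where
  "nonzero_prod V = (\<Prod>u\<in>V - {0}. u)"

text \<open>
Multiplication by \<open>c \<noteq> 0\<close> permutes the nonzero elements, hence fixes their product.
\<close>

lemma finite_field_power_card_eq_same:
  fixes c :: "'a::{field,finite}"
  shows "c ^ CARD('a) = c"
proof (cases "c = 0")
  case True
  then show ?thesis by (simp add: finite_UNIV_card_ge_0)
next
  case False
  let ?U = "UNIV - {0 :: 'a}"
  have "(\<Prod>x\<in>?U. c * x) = (\<Prod>x\<in>?U. x)"
    by (rule prod.reindex_bij_witness[of _ "\<lambda>x. x / c" "\<lambda>x. c * x"]) (use False in auto)
  then have "c ^ card ?U * (\<Prod>x\<in>?U. x) = (\<Prod>x\<in>?U. x)"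
    by (simp add: prod.distrib)
  then have "c ^ card ?U = 1"
    by simp
  moreover have "CARD('a) = Suc (card ?U)"
    by (metis card.remove finite UNIV_I)
  ultimately show ?thesis by (metis mult.right_neutral power_Suc)
qed

text \<open>
The span over the two-element field.
\<close>

fun subset_sums :: "'a::ab_group_add list \<Rightarrow> 'a set" where
  "subset_sums [] = {0}"
| "subset_sums (w # ws) = subset_sums ws \<union> (+) w ` subset_sums ws"

context
  fixes n :: nat
  assumes card_field: "CARD('a::{field,finite}) = 2 ^ n"
begin

lemma char2_double: "x + x = (0::'a)"
  by (metis CARD_power2_imp_char2[OF card_field] distrib_left mult.right_neutral mult_zero_right)

lemma char2_cancel: "x + (x + y) = (y::'a)"
  by (metis add.assoc add_0 char2_double)

lemma char2_eq_iff: "x + y = 0 \<longleftrightarrow> x = (y::'a)"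
  by (metis add.right_neutral char2_cancel char2_double)

lemma char2_minus: "- x = (x::'a)"
  by (metis char2_eq_iff add.right_inverse)

lemma char2_diff: "x - y = x + (y::'a)"
  by (metis char2_minus diff_conv_add_uminus)

lemma add_image_iff: "x \<in> (+) w ` W \<longleftrightarrow> w + x \<in> (W :: 'a set)"
  by (metis char2_cancel image_iff)

lemma coset_disjoint:
  assumes "binary_subspace W" and "(w::'a) \<notin> W"
  shows "W \<inter> (+) w ` W = {}"
proof -
  have "w \<in> W" if "x \<in> W" "w + x \<in> W" for x
    using assms(1) that unfolding binary_subspace_def by (metis add.commute char2_cancel)
  then show ?thesis using assms(2) by (auto simp: add_image_iff)
qed

interpretation f2: vector_space "f2_scale :: bit \<Rightarrow> 'a \<Rightarrow> 'a"
  by (rule vector_space_f2_scale[OF card_field])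

lemma subspace_iff: "f2.subspace V \<longleftrightarrow> binary_subspace V"
  unfolding f2.subspace_def binary_subspace_def by (auto simp: f2_scale_def)

lemma span_insert_eq: "f2.span (insert w B) = f2.span B \<union> (+) w ` f2.span B"
proof -
  have ex_bit: "(\<exists>k. P k) \<longleftrightarrow> P 0 \<or> P 1" for P :: "bit \<Rightarrow> bool"
    by (metis (full_types) bit.exhaust)
  show ?thesis
    by (rule set_eqI) (simp add: ex_bit f2.span_insert f2_scale_def add_image_iff char2_diff, metis add.commute)
qed

lemma card_extend:
  assumes "binary_subspace W" and "(w::'a) \<notin> W"
  shows "card (W \<union> (+) w ` W) = 2 * card W"
  using coset_disjoint[OF assms] by (simp add: card_Un_disjoint card_image)

lemma card_binary_subspace:
  assumes "binary_subspace (V :: 'a set)"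
  shows "card V = 2 ^ f2.dim V"
proof -
  have card_span: "card (f2.span B) = 2 ^ card B" if "finite B" "f2.independent B" for B
    using that
  proof (induction B)
    case (insert w B)
    then have "w \<notin> f2.span B" "f2.independent B"
      by (simp_all add: f2.independent_insert)
    then have "card (f2.span (insert w B)) = 2 * card (f2.span B)"
      by (simp add: span_insert_eq card_extend subspace_iff[symmetric])
    then show ?case using insert \<open>f2.independent B\<close> by simp
  qed simp
  obtain B where "B \<subseteq> V" "f2.independent B" "V \<subseteq> f2.span B" "card B = f2.dim V"
    by (rule f2.basis_exists)
  moreover from this have "f2.span B = V"
    using assms by (simp add: f2.span_subspace subspace_iff)
  ultimately show ?thesis using card_span[of B] by simp
qed

text \<open>
Building a subspace up from \<open>{0}\<close> by doubling, that is, by one basis vector at a time: the form in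
which the product formulas below are proved.
\<close>

lemma binary_subspace_induct [consumes 1, case_names zero extend]:
  assumes "binary_subspace (V :: 'a set)"
    and "P {0}"
    and "\<And>W w. binary_subspace W \<Longrightarrow> w \<notin> W \<Longrightarrow> P W \<Longrightarrow> P (W \<union> (+) w ` W)"
  shows "P V"
proof -
  have "P (f2.span B)" if "finite B" "f2.independent B" for B
    using that
  proof (induction B)
    case empty
    show ?case using assms(2) by simp
  next
    case (insert w B)
    then show ?case
      by (simp add: span_insert_eq assms(3) subspace_iff[symmetric] f2.independent_insert)
  qed
  moreover obtain B where "B \<subseteq> V" "f2.independent B" "V \<subseteq> f2.span B"
    by (rule f2.basis_exists)
  moreover from this have "f2.span B = V"
    using assms by (simp add: f2.span_subspace subspace_iff)
  ultimately show ?thesis by force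
qed

section \<open>Sums of inverses over cosets and quotients\<close>

lemma vanishing_extend:
  assumes "binary_subspace W" and "(w::'a) \<notin> W"
  shows "vanishing (W \<union> (+) w ` W) y = vanishing W y * vanishing W (y + w)"
  using coset_disjoint[OF assms]
  by (simp add: vanishing_def prod.union_disjoint prod.reindex add.assoc)

text \<open>
Doubling replaces \<open>L\<^sub>W\<close> by \<open>L\<^sub>W(y) (L\<^sub>W(y) + L\<^sub>W(w))\<close>, and \<open>z \<mapsto> z (z + c)\<close> is additive in
characteristic two because the mixed terms cancel.
\<close>

lemma vanishing_add:
  assumes "binary_subspace (V :: 'a set)"
  shows "vanishing V (x + y) = vanishing V x + vanishing V y"
  using assms
proof (induction arbitrary: x y rule: binary_subspace_induct)
  case zero
  show ?case by (simp add: vanishing_def)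
next
  case (extend W w)
  have *: "(a + b) * (a + b + c) = a * (a + c) + b * (b + c)" for a b c :: 'a
  proof -
    have "(a + b) * (a + b + c) = a * (a + c) + b * (b + c) + (a * b + a * b)"
      by (simp add: algebra_simps)
    then show ?thesis by (simp only: char2_double add_0_right)
  qed
  show ?case
    by (simp add: vanishing_extend extend *)
qed

lemma vanishing_eq_0_iff: "vanishing V y = 0 \<longleftrightarrow> (y::'a) \<in> V"
  by (auto simp: vanishing_def char2_eq_iff)

text \<open>
The derivative of the additive polynomial \<open>L\<^sub>V\<close> is its linear coefficient \<open>a(V)\<close>, so the left-hand
side is the logarithmic derivative of \<open>L\<^sub>V\<close>. The induction avoids polynomials: with \<open>b = L\<^sub>W(y)\<close> and
\<open>c = L\<^sub>W(w)\<close>, the two cosets contribute \<open>1 / b + 1 / (b + c) = c / (b (b + c))\<close>.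
\<close>

lemma coset_recip_sum:
  assumes "binary_subspace (V :: 'a set)" and "y \<notin> V"
  shows "(\<Sum>u\<in>V. inverse (y + u)) = nonzero_prod V * inverse (vanishing V y)"
  using assms
proof (induction arbitrary: y rule: binary_subspace_induct)
  case zero
  show ?case by (simp add: vanishing_def nonzero_prod_def)
next
  case (extend W w)
  let ?V = "W \<union> (+) w ` W"
  have y: "y \<notin> W" "y + w \<notin> W"
    using extend.prems add_image_iff[of y w W] by (simp_all add: add.commute[of y w])
  have disj: "W \<inter> (+) w ` W = {}"
    using extend by (simp add: coset_disjoint)
  have 0: "0 \<in> W" using extend by (simp add: binary_subspace_def)
  have "?V - {0} = (W - {0}) \<union> (+) w ` W"
    using 0 disj by blast
  then have np: "nonzero_prod ?V = nonzero_prod W * vanishing W w"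
    using disj unfolding nonzero_prod_def vanishing_def
    by (simp add: prod.union_disjoint prod.reindex Diff_Int_distrib2)
  have ne: "vanishing W y \<noteq> 0" "vanishing W y + vanishing W w \<noteq> 0"
    using y vanishing_add[OF extend.hyps(1)] by (simp_all flip: vanishing_eq_0_iff)
  have "(\<Sum>u\<in>?V. inverse (y + u)) = (\<Sum>u\<in>W. inverse (y + u)) + (\<Sum>u\<in>W. inverse (y + w + u))"
    using disj by (simp add: sum.union_disjoint sum.reindex add.assoc)
  also have "\<dots> = nonzero_prod W * (inverse (vanishing W y) + inverse (vanishing W y + vanishing W w))"
    using extend y by (simp add: vanishing_add distrib_left)
  also have "inverse (vanishing W y) + inverse (vanishing W y + vanishing W w)
      = (vanishing W y + vanishing W y + vanishing W w)
        * inverse (vanishing W y * (vanishing W y + vanishing W w))"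
    using ne by (simp add: field_simps)
  also have "\<dots> = vanishing W w * inverse (vanishing ?V y)"
    by (simp only: char2_double vanishing_extend[OF extend.hyps] vanishing_add[OF extend.hyps(1)] add_0_left)
  finally show ?case by (simp add: np)
qed

lemma vanishing_fiber:
  assumes "binary_subspace V" and "binary_subspace W" and "W \<subseteq> V" and "(y::'a) \<in> V"
  shows "{x \<in> V. vanishing W x = vanishing W y} = (+) y ` W"
proof -
  have "vanishing W x = vanishing W y \<longleftrightarrow> y + x \<in> W" for x
    by (metis assms(2) char2_eq_iff vanishing_add vanishing_eq_0_iff)
  moreover have "x \<in> V" if "y + x \<in> W" for x
    using assms that unfolding binary_subspace_def by (metis char2_cancel subsetD)
  ultimately show ?thesis
    by (intro set_eqI) (simp add: add_image_iff, blast)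
qed

text \<open>
The fibres of \<open>L\<^sub>W\<close> on \<open>V\<close> are the cosets of \<open>W\<close>. The fibre over \<open>0\<close> is \<open>W\<close> itself and the fibre over
\<open>z \<noteq> 0\<close> contributes \<open>a(W) / z\<close>.
\<close>

lemma recip_sum_quotient:
  assumes V: "binary_subspace (V :: 'a set)" and W: "binary_subspace W" and "W \<subseteq> V"
  shows "recip_sum V = recip_sum W + nonzero_prod W * recip_sum (vanishing W ` V)"
proof -
  let ?L = "vanishing W"
  \<comment> \<open>The last summand vanishes at \<open>z = 0\<close> because \<open>inverse 0 = 0\<close>.\<close>
  have fiber: "(\<Sum>x\<in>{x\<in>V. ?L x = z}. inverse x)
      = (if z = 0 then recip_sum W else 0) + nonzero_prod W * inverse z" if "z \<in> ?L ` V" for z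
  proof -
    from that obtain y where y: "y \<in> V" "z = ?L y" by blast
    have "(\<Sum>x\<in>{x\<in>V. ?L x = z}. inverse x) = (\<Sum>u\<in>W. inverse (y + u))"
      using vanishing_fiber[OF V W assms(3) y(1)] by (simp add: y(2) sum.reindex)
    moreover have "(\<Sum>u\<in>W. inverse (y + u)) = recip_sum W" if "y \<in> W"
      unfolding recip_sum_def
      by (rule sum.reindex_bij_witness[of _ "\<lambda>u. y + u" "\<lambda>u. y + u"])
         (use W that in \<open>auto simp: char2_cancel binary_subspace_def\<close>)
    ultimately show ?thesis
      using coset_recip_sum[OF W, of y] y by (auto simp: vanishing_eq_0_iff)
  qed
  have "0 \<in> ?L ` V"
    using V W by (metis binary_subspace_def imageI vanishing_eq_0_iff)
  then have "(\<Sum>z\<in>?L ` V. if z = 0 then recip_sum W else 0) = recip_sum W"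
    by simp
  moreover have "recip_sum V = (\<Sum>z\<in>?L ` V. \<Sum>x\<in>{x\<in>V. ?L x = z}. inverse x)"
    unfolding recip_sum_def by (rule sum.image_gen) simp
  ultimately show ?thesis
    by (simp add: fiber sum.distrib sum_distrib_left recip_sum_def cong: sum.cong)
qed

lemma card_quotient:
  assumes V: "binary_subspace (V :: 'a set)" and W: "binary_subspace W" and "W \<subseteq> V"
  shows "card V = card W * card (vanishing W ` V)"
proof -
  have "card {x\<in>V. vanishing W x = z} = card W" if "z \<in> vanishing W ` V" for z
    using that vanishing_fiber[OF V W assms(3)] by (auto simp: card_image)
  then show ?thesis
    using sum.image_gen[of V "\<lambda>_. 1::nat" "vanishing W"] by (simp cong: sum.cong)
qed

lemma binary_subspace_image:
  assumes "binary_subspace (V :: 'a set)" and "\<And>x y :: 'a. f (x + y) = f x + (f y :: 'a)"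
  shows "binary_subspace (f ` V)"
proof -
  have "f 0 = 0"
    by (metis add_0 assms(2) char2_double)
  then show ?thesis
    using assms(1) unfolding binary_subspace_def
    by (auto simp flip: assms(2))
qed

text \<open>
The sum is invariant under multiplication by an element \<open>c\<close> other than \<open>0\<close> and \<open>1\<close>, which exists
because the field has more than two elements.
\<close>

lemma recip_sum_UNIV:
  assumes "2 \<le> n"
  shows "recip_sum (UNIV :: 'a set) = 0"
proof -
  have "\<not> (UNIV :: 'a set) \<subseteq> {0, 1}"
  proof
    assume "(UNIV :: 'a set) \<subseteq> {0, 1}"
    then have "CARD('a) \<le> card {0, 1 :: 'a}"
      by (intro card_mono) auto
    then show False
      using power_increasing[OF assms, of "2::nat"] by (simp add: card_field)
  qed
  then obtain c :: 'a where c: "c \<noteq> 0" "c \<noteq> 1" by blast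
  have "(\<Sum>x\<in>UNIV. inverse (c * x)) = (\<Sum>x\<in>UNIV. inverse (x::'a))"
    by (rule sum.reindex_bij_witness[of _ "\<lambda>x. x / c" "\<lambda>x. c * x"]) (use c in auto)
  then have "(inverse c - 1) * recip_sum (UNIV :: 'a set) = 0"
    by (simp add: recip_sum_def sum_distrib_left[symmetric] left_diff_distrib)
  then show ?thesis using c by simp
qed

text \<open>
The dual of \<open>V\<close> is the image of the field under \<open>L\<^sub>V\<close>.
\<close>

lemma dual_subspace:
  assumes "binary_subspace (V :: 'a set)" and "card V = 2 ^ k" and "recip_sum V = 0"
    and "2 \<le> n" and "k \<le> n"
  shows "\<exists>G :: 'a set. binary_subspace G \<and> card G = 2 ^ (n - k) \<and> recip_sum G = 0"
proof (intro exI conjI)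
  let ?G = "range (vanishing V)"
  have U: "binary_subspace (UNIV :: 'a set)" by (simp add: binary_subspace_def)
  show "binary_subspace ?G"
    by (rule binary_subspace_image[OF U]) (rule vanishing_add[OF assms(1)])
  have "2 ^ n = 2 ^ k * card ?G"
    using card_quotient[OF U assms(1)] by (simp add: card_field assms(2))
  moreover have "(2::nat) ^ n = 2 ^ k * 2 ^ (n - k)"
    using assms(5) by (simp flip: power_add)
  ultimately show "card ?G = 2 ^ (n - k)" by simp
  have "nonzero_prod V \<noteq> 0" by (simp add: nonzero_prod_def)
  then show "recip_sum ?G = 0"
    using recip_sum_quotient[OF U assms(1)] recip_sum_UNIV[OF assms(4)] assms(3) by simp
qed

text \<open>
An affine subspace is either a linear one or a coset that misses \<open>0\<close>; the latter never has sum zero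
by \<open>coset_recip_sum\<close>.
\<close>

lemma sum_free_f_inv_iff:
  "sum_free_of_order k (f_inv :: 'a \<Rightarrow> 'a) \<longleftrightarrow>
    (\<forall>V :: 'a set. binary_subspace V \<and> card V = 2 ^ k \<longrightarrow> recip_sum V \<noteq> 0)"
proof -
  have inv: "f_inv = (inverse :: 'a \<Rightarrow> 'a)"
    by (auto simp: f_inv_def)
  have dim: "f2.dim V = k \<longleftrightarrow> card V = 2 ^ k" if "binary_subspace V" for V
    using card_binary_subspace[OF that] by simp
  have shift: "(\<Sum>x\<in>(+) a ` V. inverse x) = (if a \<in> V then recip_sum V
      else nonzero_prod V * inverse (vanishing V a))" if V: "binary_subspace V" for a and V :: "'a set"
  proof (cases "a \<in> V")
    case True
    then have "(+) a ` V = V"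
      using V unfolding binary_subspace_def by (auto simp: add_image_iff)
    then show ?thesis using True by (simp add: recip_sum_def)
  next
    case False
    then show ?thesis using coset_recip_sum[OF V] by (simp add: sum.reindex)
  qed
  have "nonzero_prod V * inverse (vanishing V a) \<noteq> 0" if "a \<notin> V" for a and V :: "'a set"
    using that by (simp add: nonzero_prod_def vanishing_eq_0_iff)
  then show ?thesis
    unfolding sum_free_of_order_def affine_subspace_of_dim_def inv subspace_iff
    using shift dim by (smt (verit, ccfv_threshold) binary_subspace_def)
qed

section \<open>Lines and planes\<close>

lemma line_subspace: "binary_subspace {0, w :: 'a}"
  by (auto simp: binary_subspace_def char2_double)

text \<open>
The quotient formula for \<open>W = {0, w}\<close>, where \<open>s(W) = 1 / w\<close>, \<open>a(W) = w\<close> and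
\<open>L\<^sub>W(x) = (x + w) x\<close>.
\<close>

lemma line_quotient:
  assumes "binary_subspace V" and "w \<in> V" and "(w::'a) \<noteq> 0"
  shows "recip_sum V = inverse w + w * recip_sum ((\<lambda>x. (x + w) * x) ` V)"
    and "card V = 2 * card ((\<lambda>x. (x + w) * x) ` V)"
proof -
  have van: "vanishing {0, w} = (\<lambda>x. (x + w) * x)"
    using assms(3) by (auto simp: vanishing_def mult.commute)
  have "{0, w} - {0} = {w}" using assms(3) by auto
  then have "recip_sum {0, w} = inverse w" "nonzero_prod {0, w} = w"
    using assms(3) by (simp_all add: recip_sum_def nonzero_prod_def)
  moreover have "{0, w} \<subseteq> V"
    using assms by (simp add: binary_subspace_def)
  ultimately show "recip_sum V = inverse w + w * recip_sum ((\<lambda>x. (x + w) * x) ` V)"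
    and "card V = 2 * card ((\<lambda>x. (x + w) * x) ` V)"
    using recip_sum_quotient[OF assms(1) line_subspace, of w] assms(3)
      card_quotient[OF assms(1) line_subspace, of w] by (simp_all add: van)
qed

lemma line_exhaust:
  assumes "binary_subspace (V :: 'a set)" and "card V = 2"
  obtains g where "g \<noteq> 0" and "V = {0, g}"
proof -
  obtain a b where "V = {a, b}" "a \<noteq> b"
    using assms(2) by (auto simp: card_2_iff)
  then show thesis
    using assms(1) that unfolding binary_subspace_def by auto
qed

lemma recip_sum_line_nonzero:
  assumes "binary_subspace (V :: 'a set)" and "card V = 2"
  shows "recip_sum V \<noteq> 0"
  using assms by (auto elim!: line_exhaust simp: recip_sum_def)

text \<open>
If \<open>V\<close> is spanned by \<open>w\<close> and \<open>v\<close>, a zero sum means \<open>(v + w) v = w\<^sup>2\<close>. Then \<open>t = v / w\<close> satisfies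
\<open>t\<^sup>2 + t + 1 = 0\<close>, so \<open>t ^ 3 = 1\<close>. As \<open>2 ^ n\<close> is \<open>2\<close> modulo \<open>3\<close> for odd \<open>n\<close>, the identity
\<open>t ^ (2 ^ n) = t\<close> becomes \<open>t\<^sup>2 = t\<close>, which contradicts the equation for \<open>t\<close>.
\<close>

lemma recip_sum_plane_nonzero:
  assumes "odd n" and V: "binary_subspace (V :: 'a set)" and "card V = 4"
  shows "recip_sum V \<noteq> 0"
proof
  assume zero: "recip_sum V = 0"
  obtain w where w: "w \<in> V" "w \<noteq> 0"
  proof -
    have "\<not> V \<subseteq> {0}" using assms(3) card_mono[of "{0::'a}" V] by auto
    then show thesis using that by blast
  qed
  define \<phi> where "\<phi> x = (x + w) * x" for x
  have "vanishing {0, w} = \<phi>"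
    using w by (auto simp: vanishing_def \<phi>_def mult.commute)
  then have "binary_subspace (\<phi> ` V)"
    using V vanishing_add[OF line_subspace, of w] by (auto intro: binary_subspace_image)
  moreover have "card (\<phi> ` V) = 2"
    using line_quotient(2)[OF V w] assms(3) unfolding \<phi>_def by simp
  ultimately obtain g where g: "g \<noteq> 0" "\<phi> ` V = {0, g}"
    by (rule line_exhaust)
  obtain v where v: "\<phi> v = g" using g(2) by (metis imageE insertCI)
  have "inverse w + w * inverse g = 0"
    using line_quotient(1)[OF V w] zero g by (simp add: \<phi>_def recip_sum_def)
  then have "inverse w = w * inverse g"
    by (simp add: char2_eq_iff)
  then have "g = w * w"
    using w(2) g(1) by (simp add: field_simps)
  define t where "t = v / w"
  have "(t + 1) * t * (w * w) = \<phi> v"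
    using w(2) by (simp add: t_def \<phi>_def field_simps)
  then have t: "(t + 1) * t = 1"
    using v w(2) \<open>g = w * w\<close> by simp
  then have t2: "t * t = t + 1"
    by (simp add: algebra_simps) (metis add.commute char2_cancel)
  then have t3: "t ^ 3 = 1"
    using t by (simp add: power3_eq_cube)
  obtain m where m: "(2::nat) ^ n = 3 * m + 2"
  proof -
    obtain j where "n = 2 * j + 1" using assms(1) by (rule oddE)
    moreover have "\<exists>m. (2::nat) ^ (2 * j + 1) = 3 * m + 2"
    proof (induction j)
      case (Suc j)
      then obtain m where "(2::nat) ^ (2 * j + 1) = 3 * m + 2" by blast
      then have "(2::nat) ^ (2 * Suc j + 1) = 3 * (4 * m + 2) + 2" by simp
      then show ?case by blast
    qed simp
    ultimately show thesis using that by blast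
  qed
  have "t = t ^ (3 * m + 2)"
    using finite_field_power_card_eq_same[of t] by (simp add: card_field m)
  also have "\<dots> = t + 1"
    by (simp add: power_add power_mult t3 power2_eq_square t2)
  finally show False by simp
qed

section \<open>The sum of inverses from a basis\<close>

lemma binary_subspace_subset_sums: "binary_subspace (subset_sums (ws :: 'a list))"
proof (induction ws)
  case (Cons w ws)
  let ?S = "subset_sums ws"
  have mem: "x \<in> subset_sums (w # ws) \<longleftrightarrow> x \<in> ?S \<or> w + x \<in> ?S" for x
    by (simp add: add_image_iff)
  have closed: "x + y \<in> ?S" if "x \<in> ?S" "y \<in> ?S" for x y
    using Cons that by (simp add: binary_subspace_def)
  have "x + y \<in> ?S \<or> w + (x + y) \<in> ?S" if "x \<in> ?S \<or> w + x \<in> ?S" "y \<in> ?S \<or> w + y \<in> ?S" for x y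
  proof -
    have "(w + x) + y = w + (x + y)" "x + (w + y) = w + (x + y)" "(w + x) + (w + y) = x + y"
      by (simp_all add: ac_simps char2_cancel)
    then show ?thesis
      using that closed[of x y] closed[of "w + x" y] closed[of x "w + y"] closed[of "w + x" "w + y"]
      by presburger
  qed
  then show ?case
    using Cons by (simp only: binary_subspace_def Ball_def mem) blast
qed (simp add: binary_subspace_def)

lemma subset_sums_image:
  assumes "\<And>x y :: 'a. f (x + y) = f x + (f y :: 'a)"
  shows "f ` subset_sums ws = subset_sums (map f ws)"
proof (induction ws)
  case Nil
  have "f 0 = 0" by (metis add_0 assms char2_double)
  then show ?case by simp
next
  case (Cons w ws)
  then show ?case
    by (simp add: image_Un image_image assms flip: Cons)
qed

end

text \<open>
Numerator and denominator of \<open>s\<close> on the span of a list, by the quotient formula for the line through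
the first vector: \<open>1 / w + w (N / D) = (D + w\<^sup>2 N) / (w D)\<close>. A fraction keeps the computation free of
divisions.
\<close>

fun recip_frac :: "'a::field list \<Rightarrow> 'a \<times> 'a" where
  "recip_frac [] = (0, 1)"
| "recip_frac (w # ws) =
    (case recip_frac (map (\<lambda>x. (x + w) * x) ws) of (N, D) \<Rightarrow> (D + w * (w * N), w * D))"

text \<open>
The denominator is the product of the vectors that come first at the successive stages. Each of them is
the value of \<open>L\<^sub>W\<close> at a given vector, where \<open>W\<close> is the span of the vectors before it. So \<open>D \<noteq> 0\<close> also
certifies that the list is linearly independent, which gives the cardinality.
\<close>

lemma recip_frac_subset_sums:
  fixes ws :: "'a::{field,finite} list"
  assumes card_field: "CARD('a) = 2 ^ n"
    and "recip_frac ws = (N, D)" and "D \<noteq> 0"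
  shows "card (subset_sums ws) = 2 ^ length ws" and "recip_sum (subset_sums ws) * D = N"
proof -
  have "card (subset_sums ws) = 2 ^ length ws \<and> recip_sum (subset_sums ws) * D = N"
    using assms(2,3)
  proof (induction ws arbitrary: N D rule: recip_frac.induct)
    case 1
    then show ?case by (simp add: recip_sum_def)
  next
    case (2 w ws)
    let ?\<phi> = "\<lambda>x. (x + w) * x" and ?V = "subset_sums (w # ws)"
    obtain N' D' where frac: "recip_frac (map ?\<phi> ws) = (N', D')"
      by fastforce
    with "2.prems" have N: "N = D' + w * (w * N')" and D: "D = w * D'" and ne: "w \<noteq> 0" "D' \<noteq> 0"
      by auto
    have IH: "card (subset_sums (map ?\<phi> ws)) = 2 ^ length ws"
      "recip_sum (subset_sums (map ?\<phi> ws)) * D' = N'"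
      using "2.IH"[OF frac ne(2)] by simp_all
    have "?\<phi> (x + y) = ?\<phi> x + ?\<phi> y" for x y
    proof -
      have "?\<phi> (x + y) = ?\<phi> x + ?\<phi> y + (x * y + x * y)"
        by (simp add: algebra_simps)
      then show ?thesis
        by (simp only: char2_double[OF card_field] add_0_right)
    qed
    then have "?\<phi> ` ?V = subset_sums (map ?\<phi> (w # ws))"
      by (rule subset_sums_image[OF card_field])
    also have "\<dots> = subset_sums (map ?\<phi> ws)"
      by (simp add: char2_double[OF card_field])
    finally have image: "?\<phi> ` ?V = subset_sums (map ?\<phi> ws)" .
    have V: "binary_subspace ?V"
      by (rule binary_subspace_subset_sums[OF card_field])
    have "w \<in> ?V"
      using binary_subspace_subset_sums[OF card_field, of ws]
      by (auto simp: binary_subspace_def image_iff)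
    note line = line_quotient[OF card_field V this ne(1), unfolded image IH(1)]
    have "recip_sum ?V * D = N"
      using ne unfolding line(1) N D IH(2)[symmetric] by (simp add: field_simps)
    then show ?case using line(2) by simp
  qed
  then show "card (subset_sums ws) = 2 ^ length ws" "recip_sum (subset_sums ws) * D = N"
    by simp_all
qed

section \<open>Binary polynomials as lists of bits\<close>

text \<open>
A list of bits stands for the polynomial over the two-element field that has these coefficients,
constant term first. Lists are not normalised: zeros at the end are allowed.
\<close>

fun bit_add :: "bool list \<Rightarrow> bool list \<Rightarrow> bool list" where
  "bit_add [] bs = bs"
| "bit_add (a # as) [] = a # as"
| "bit_add (False # as) (b # bs) = b # bit_add as bs"
| "bit_add (True # as) (b # bs) = (\<not> b) # bit_add as bs"

fun bit_mult :: "bool list \<Rightarrow> bool list \<Rightarrow> bool list" where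
  "bit_mult [] bs = []"
| "bit_mult (False # as) bs = False # bit_mult as bs"
| "bit_mult (True # as) bs = bit_add bs (False # bit_mult as bs)"

text \<open>
The length of the first list is the degree at which a polynomial is cut. As a unary number it keeps
the cut at one rewrite step per coefficient.
\<close>

fun low_part :: "bool list \<Rightarrow> bool list \<Rightarrow> bool list" where
  "low_part [] as = []"
| "low_part (t # ts) [] = []"
| "low_part (t # ts) (a # as) = a # low_part ts as"

fun high_part :: "bool list \<Rightarrow> bool list \<Rightarrow> bool list" where
  "high_part [] as = as"
| "high_part (t # ts) [] = []"
| "high_part (t # ts) (a # as) = high_part ts as"

text \<open>
One step of reduction modulo \<open>p = X ^ n + r\<close> with \<open>n = length ts\<close>: the part of degree at least \<open>n\<close>
is multiplied by \<open>r\<close> instead of \<open>X ^ n\<close>.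
\<close>

definition fold_down :: "bool list \<Rightarrow> bool list \<Rightarrow> bool list \<Rightarrow> bool list" where
  "fold_down ts r as = bit_add (low_part ts as) (bit_mult r (high_part ts as))"

text \<open>
When \<open>r\<close> has small degree, two steps bring a product of two reduced factors back below degree \<open>n\<close>.
For any \<open>r\<close> the result is congruent to the product modulo \<open>p\<close>.
\<close>

definition mod_mult :: "bool list \<Rightarrow> bool list \<Rightarrow> bool list \<Rightarrow> bool list \<Rightarrow> bool list" where
  "mod_mult ts r as bs = fold_down ts r (fold_down ts r (bit_mult as bs))"

fun is_zero :: "bool list \<Rightarrow> bool" where
  "is_zero [] = True"
| "is_zero (True # as) = False"
| "is_zero (False # as) = is_zero as"

fun bit_eval :: "'a::comm_ring_1 \<Rightarrow> bool list \<Rightarrow> 'a" where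
  "bit_eval x [] = 0"
| "bit_eval x (a # as) = of_bool a + x * bit_eval x as"

lemma double_eq_0:
  assumes "(1 :: 'a::comm_ring_1) + 1 = 0"
  shows "y + y = (0::'a)"
  by (metis assms distrib_left mult.right_neutral mult_zero_right)

lemma bit_eval_add:
  assumes "(1 :: 'a::comm_ring_1) + 1 = 0"
  shows "bit_eval (x::'a) (bit_add as bs) = bit_eval x as + bit_eval x bs"
proof (induction as bs rule: bit_add.induct)
  case (4 as b bs)
  then show ?case
    using assms by (cases b) (simp_all add: algebra_simps)
qed (simp_all add: algebra_simps)

lemma bit_eval_mult:
  assumes "(1 :: 'a::comm_ring_1) + 1 = 0"
  shows "bit_eval (x::'a) (bit_mult as bs) = bit_eval x as * bit_eval x bs"
  by (induction as bs rule: bit_mult.induct) (simp_all add: bit_eval_add[OF assms] algebra_simps)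

lemma bit_eval_split:
  "bit_eval x as = bit_eval x (low_part ts as) + x ^ length ts * bit_eval x (high_part ts as)"
  by (induction ts as rule: low_part.induct) (simp_all add: algebra_simps)

lemma bit_eval_zero: "is_zero as \<Longrightarrow> bit_eval x as = 0"
  by (induction as rule: is_zero.induct) simp_all

text \<open>
The bit operations are compared with ring operations up to multiples of \<open>p(x)\<close>, in an arbitrary
commutative ring of characteristic two. The ring will be the polynomial ring with \<open>x = X\<close>, to show that
\<open>p\<close> divides \<open>X ^ (2 ^ n) - X\<close>, and then the field with \<open>x\<close> a root of \<open>p\<close>, where congruence becomes
equality.
\<close>

lemma bit_eval_fold_down:
  assumes "(1 :: 'a::comm_ring_1) + 1 = 0"
  shows "x ^ length ts + bit_eval (x::'a) r dvd bit_eval x (fold_down ts r as) - bit_eval x as"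
proof -
  let ?h = "bit_eval x (high_part ts as)"
  have "bit_eval x r * ?h = - (bit_eval x r * ?h)"
    using double_eq_0[OF assms] by (simp add: eq_neg_iff_add_eq_0)
  then have "bit_eval x (fold_down ts r as) - bit_eval x as
      = - ((x ^ length ts + bit_eval x r) * ?h)"
    unfolding bit_eval_split[of x as ts] fold_down_def
    by (simp add: bit_eval_add[OF assms] bit_eval_mult[OF assms] algebra_simps)
  then show ?thesis by simp
qed

lemma bit_eval_mod_mult:
  assumes "(1 :: 'a::comm_ring_1) + 1 = 0"
  shows "x ^ length ts + bit_eval (x::'a) r dvd
    bit_eval x (mod_mult ts r as bs) - bit_eval x as * bit_eval x bs"
  unfolding mod_mult_def bit_eval_mult[OF assms, symmetric]
  using dvd_add[OF bit_eval_fold_down[OF assms] bit_eval_fold_down[OF assms]]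
  by (metis (no_types, lifting) diff_add_cancel add_diff_eq)

fun iterate_square :: "bool list \<Rightarrow> bool list \<Rightarrow> bool list \<Rightarrow> bool list \<Rightarrow> bool list" where
  "iterate_square ts r [] as = as"
| "iterate_square ts r (y # ys) as = iterate_square ts r ys (mod_mult ts r as as)"

lemma bit_eval_iterate_square:
  assumes "(1 :: 'a::comm_ring_1) + 1 = 0"
  shows "x ^ length ts + bit_eval (x::'a) r dvd
    bit_eval x (iterate_square ts r ys as) - bit_eval x as ^ (2 ^ length ys)"
proof (induction ys arbitrary: as)
  case (Cons y ys)
  let ?p = "x ^ length ts + bit_eval x r" and ?m = "bit_eval x (mod_mult ts r as as)"
  have "?p dvd ?m - (bit_eval x as)\<^sup>2"
    using bit_eval_mod_mult[OF assms] by (simp add: power2_eq_square)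
  moreover have "?m - (bit_eval x as)\<^sup>2 dvd ?m ^ (2 ^ length ys) - ((bit_eval x as)\<^sup>2) ^ (2 ^ length ys)"
    by (metis dvd_triv_left power_diff_sumr2)
  ultimately have "?p dvd ?m ^ (2 ^ length ys) - bit_eval x as ^ (2 ^ length (y # ys))"
    by (simp only: length_Cons power_Suc power_mult) (rule dvd_trans)
  from dvd_add[OF Cons[of "mod_mult ts r as as"] this] show ?case
    by simp
qed simp

text \<open>
The test that \<open>n\<close> squarings take \<open>X\<close> back to itself modulo \<open>p = X ^ n + r\<close>. The list \<open>ts\<close> of length
\<open>n\<close> doubles as loop counter, and the first conjunct says that \<open>r\<close> has length below \<open>n\<close>, so that \<open>p\<close>
has degree \<open>n\<close>.
\<close>

definition splits :: "bool list \<Rightarrow> bool list \<Rightarrow> bool" where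
  "splits ts r \<longleftrightarrow> high_part ts (True # r) = [] \<and>
    is_zero (bit_add [False, True] (iterate_square ts r ts [False, True]))"

lemma high_part_Nil_iff: "high_part ts as = [] \<longleftrightarrow> length as \<le> length ts"
  by (induction ts as rule: high_part.induct) simp_all

lemma degree_bit_eval: "degree (bit_eval [:0, 1 :: 'a::comm_ring_1:] as) \<le> length as - 1"
proof (induction as)
  case (Cons a as)
  have "bit_eval [:0, 1:] (a # as) = pCons (of_bool a) (bit_eval [:0, 1 :: 'a:] as)"
    by (cases a) (simp_all add: one_pCons)
  moreover have "bit_eval [:0, 1 :: 'a:] as = 0" if "as = []"
    using that by simp
  ultimately show ?case
    using Cons degree_pCons_le[of "of_bool a" "bit_eval [:0, 1 :: 'a:] as"]
    by (cases as) auto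
qed simp

lemma poly_bit_eval: "poly (bit_eval p as) c = bit_eval (poly p c) as"
  by (induction as) simp_all

text \<open>
Every element of the field is a zero of \<open>X ^ (2 ^ n) + X = p q\<close>. If \<open>p\<close> had no zero, then \<open>q\<close> would
vanish at all \<open>2 ^ n\<close> elements, although its degree is only \<open>2 ^ n - n\<close>.
\<close>

lemma splits_root:
  assumes card_field: "CARD('a::{field,finite}) = 2 ^ n"
    and "length ts = n" and "splits ts r"
  obtains \<alpha> :: "'a::{field,finite}" where "\<alpha> ^ n + bit_eval \<alpha> r = 0"
proof -
  let ?X = "[:0, 1 :: 'a:]"
  define p where "p = ?X ^ n + bit_eval ?X r"
  have char2: "(1::'a) + 1 = 0"
    by (rule CARD_power2_imp_char2[OF card_field])
  then have char2_poly: "(1 :: 'a poly) + 1 = 0"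
    by (simp add: one_pCons)
  have len: "length r < n"
    using assms(2,3) by (simp add: splits_def high_part_Nil_iff)
  have "bit_eval ?X [False, True] + bit_eval ?X (iterate_square ts r ts [False, True]) = 0"
    using assms(3) unfolding splits_def
    by (simp only: bit_eval_add[OF char2_poly, symmetric] bit_eval_zero)
  moreover have "p dvd bit_eval ?X (iterate_square ts r ts [False, True]) - ?X ^ (2 ^ n)"
    using bit_eval_iterate_square[OF char2_poly, of ?X ts r ts "[False, True]"] assms(2)
    by (simp add: p_def)
  ultimately have "p dvd - ?X - ?X ^ (2 ^ n)"
    by (simp add: add_eq_0_iff)
  then have "p dvd ?X ^ (2 ^ n) + ?X"
    by (metis add_uminus_conv_diff dvd_minus_iff minus_add_distrib add.commute)
  then obtain q where q: "?X ^ (2 ^ n) + ?X = p * q" by (rule dvdE)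
  have "2 ^ n > (1::nat)"
    using len by (intro one_less_power) auto
  then have deg: "degree (?X ^ (2 ^ n) + ?X) = 2 ^ n"
    by (subst degree_add_eq_left) (simp_all add: degree_power_eq)
  have "degree (bit_eval ?X r) < n"
    using degree_bit_eval[where 'a = 'a and as = r] len by linarith
  then have degp: "degree p = n"
    unfolding p_def by (subst degree_add_eq_left) (simp_all add: degree_power_eq)
  have ne: "p \<noteq> 0" "q \<noteq> 0"
    using deg q by auto
  have "\<exists>\<alpha>. poly p \<alpha> = 0"
  proof (rule ccontr)
    assume no_root: "\<nexists>\<alpha>. poly p \<alpha> = 0"
    have "poly p c * poly q c = c + c" for c
      unfolding poly_mult[symmetric] q[symmetric]
      using finite_field_power_card_eq_same[of c] by (simp add: card_field)
    then have "poly q c = 0" for c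
      using no_root char2_double[OF card_field] by (metis mult_eq_0_iff)
    then have "2 ^ n \<le> degree q"
      using card_poly_roots_bound[OF ne(2)] by (simp add: card_field)
    moreover have "2 ^ n = n + degree q"
      using deg degp ne by (simp add: q degree_mult_eq)
    ultimately show False using len by simp
  qed
  then show thesis
    using that by (auto simp: p_def poly_bit_eval)
qed

section \<open>Certificates for subspaces with vanishing sum\<close>

text \<open>
The recursion of \<open>recip_frac\<close> on bit lists modulo \<open>p\<close>. The auxiliary functions \<open>reduce_all\<close> and
\<open>frac_step\<close> replace a mapped abstraction and a case distinction: their arguments are brought to normal
form before they are unfolded, so that rewriting evaluates each product once.
\<close>

fun reduce_all :: "bool list \<Rightarrow> bool list \<Rightarrow> bool list \<Rightarrow> bool list list \<Rightarrow> bool list list" where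
  "reduce_all ts r w [] = []"
| "reduce_all ts r w (x # xs) = mod_mult ts r (bit_add x w) x # reduce_all ts r w xs"

lemma length_reduce_all [simp]: "length (reduce_all ts r w xs) = length xs"
  by (induction xs) simp_all

fun frac_step :: "bool list \<Rightarrow> bool list \<Rightarrow> bool list \<Rightarrow> bool list \<times> bool list \<Rightarrow> bool list \<times> bool list" where
  "frac_step ts r w (N, D) = (bit_add D (mod_mult ts r w (mod_mult ts r w N)), mod_mult ts r w D)"

fun bit_frac :: "bool list \<Rightarrow> bool list \<Rightarrow> bool list list \<Rightarrow> bool list \<times> bool list" where
  "bit_frac ts r [] = ([], [True])"
| "bit_frac ts r (w # ws) = frac_step ts r w (bit_frac ts r (reduce_all ts r w ws))"

text \<open>
The certificate \<open>i\<close> is an inverse of the denominator and so shows that it is not zero.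
\<close>

fun vanishes :: "bool list \<Rightarrow> bool list \<Rightarrow> bool list \<Rightarrow> bool list \<times> bool list \<Rightarrow> bool" where
  "vanishes ts r i (N, D) \<longleftrightarrow> is_zero N \<and> is_zero (bit_add [True] (mod_mult ts r i D))"

text \<open>
The certificates write binary polynomials as numbers, which keeps them short.
\<close>

fun bits :: "nat \<Rightarrow> bool list" where
  "bits m = (if m = 0 then [] else odd m # bits (m div 2))"

declare bits.simps [simp del]

text \<open>
The list \<open>ms\<close> holds monomials that start a basis, and a row \<open>(c, v, i)\<close> completes it by \<open>c\<close> and
\<open>v\<close>. From one row to the next, the list \<open>1, X, \<dots>, X ^ j\<close> grows by one power, and so does the dimension.
\<close>

fun check_rows :: "bool list \<Rightarrow> bool list \<Rightarrow> bool list list \<Rightarrow> (nat \<times> nat \<times> nat) list \<Rightarrow> bool" where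
  "check_rows ts r ms [] = True"
| "check_rows ts r ms ((c, v, i) # rows) \<longleftrightarrow>
    vanishes ts r (bits i) (bit_frac ts r (ms @ [bits c, bits v])) \<and>
    check_rows ts r ([True] # map ((#) False) ms) rows"

text \<open>
Starting from the single monomial \<open>1\<close>, row number \<open>j\<close>, counted from \<open>0\<close>, belongs to dimension
\<open>k = j + 3\<close> and to the basis \<open>1, \<alpha>, \<dots>, \<alpha> ^ (k - 3), c, v\<close>, where \<open>\<alpha>\<close> is a root of \<open>X ^ n + r\<close>.
\<close>

definition certified :: "nat \<Rightarrow> nat \<Rightarrow> (nat \<times> nat \<times> nat) list \<Rightarrow> bool" where
  "certified n r rows \<longleftrightarrow>
    splits (replicate n False) (bits r) \<and> check_rows (replicate n False) (bits r) [[True]] rows"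

context
  fixes n :: nat and \<alpha> :: "'a::{field,finite}" and ts r :: "bool list"
  assumes card_field: "CARD('a) = 2 ^ n"
    and len: "length ts = n"
    and root: "\<alpha> ^ n + bit_eval \<alpha> r = 0"
begin

lemma eval_add: "bit_eval \<alpha> (bit_add as bs) = bit_eval \<alpha> as + bit_eval \<alpha> bs"
  by (rule bit_eval_add[OF CARD_power2_imp_char2[OF card_field]])

lemma eval_mod_mult: "bit_eval \<alpha> (mod_mult ts r as bs) = bit_eval \<alpha> as * bit_eval \<alpha> bs"
  using bit_eval_mod_mult[OF CARD_power2_imp_char2[OF card_field], of \<alpha> ts r as bs] len root
  by simp

lemma eval_reduce_all:
  "map (bit_eval \<alpha>) (reduce_all ts r w xs) =
    map (\<lambda>x. (x + bit_eval \<alpha> w) * x) (map (bit_eval \<alpha>) xs)"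
  by (induction xs) (simp_all add: eval_add eval_mod_mult)

lemma eval_bit_frac:
  "recip_frac (map (bit_eval \<alpha>) ws) = map_prod (bit_eval \<alpha>) (bit_eval \<alpha>) (bit_frac ts r ws)"
proof (induction "length ws" arbitrary: ws)
  case (Suc l)
  then obtain w us where ws: "ws = w # us" by (cases ws) auto
  obtain N D where ND: "bit_frac ts r (reduce_all ts r w us) = (N, D)" by fastforce
  have "recip_frac (map (bit_eval \<alpha>) (reduce_all ts r w us)) = (bit_eval \<alpha> N, bit_eval \<alpha> D)"
    using Suc ws ND by simp
  then show ?case
    by (simp add: ws ND eval_reduce_all eval_add eval_mod_mult comp_def)
qed simp

lemma vanishes_subspace:
  assumes "vanishes ts r i (bit_frac ts r ws)"
  shows "\<exists>V :: 'a set. binary_subspace V \<and> card V = 2 ^ length ws \<and> recip_sum V = 0"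
proof -
  obtain N D where ND: "bit_frac ts r ws = (N, D)" by fastforce
  have "bit_eval \<alpha> N = 0"
    using assms by (simp add: ND bit_eval_zero)
  moreover have "1 + bit_eval \<alpha> i * bit_eval \<alpha> D = 0"
    using assms bit_eval_zero[of "bit_add [True] (mod_mult ts r i D)" \<alpha>]
    by (simp add: ND eval_add eval_mod_mult)
  moreover from this have "bit_eval \<alpha> D \<noteq> 0" by auto
  ultimately show ?thesis
    using recip_frac_subset_sums[OF card_field, of "map (bit_eval \<alpha>) ws"]
      binary_subspace_subset_sums[OF card_field]
    by (metis ND eval_bit_frac length_map map_prod_simp mult_eq_0_iff)
qed

lemma check_rows_subspace:
  assumes "check_rows ts r ms rows" and "j < length rows"
  shows "\<exists>V :: 'a set. binary_subspace V \<and> card V = 2 ^ (length ms + 2 + j) \<and> recip_sum V = 0"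
  using assms
proof (induction rows arbitrary: ms j)
  case (Cons row rows)
  obtain c v i where row: "row = (c, v, i)" by (cases row)
  show ?case
  proof (cases j)
    case 0
    then show ?thesis
      using Cons.prems(1) vanishes_subspace[of "bits i" "ms @ [bits c, bits v]"]
      by (simp add: row)
  next
    case (Suc j')
    then show ?thesis
      using Cons.prems Cons.IH[of "[True] # map ((#) False) ms" j'] by (simp add: row)
  qed
qed simp

end

lemma certified_subspace:
  assumes card_field: "CARD('a::{field,finite}) = 2 ^ n"
    and "certified n r rows" and "3 \<le> k" and "k < 3 + length rows"
  shows "\<exists>V :: 'a set. binary_subspace V \<and> card V = 2 ^ k \<and> recip_sum V = 0"
proof -
  let ?ts = "replicate n False"
  have cert: "splits ?ts (bits r)" "check_rows ?ts (bits r) [[True]] rows"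
    using assms(2) by (simp_all add: certified_def)
  obtain \<alpha> :: 'a where "\<alpha> ^ n + bit_eval \<alpha> (bits r) = 0"
    using splits_root[OF card_field _ cert(1)] by auto
  moreover obtain j where "k = 3 + j" "j < length rows"
    using assms(3,4) by (auto simp: le_iff_add)
  ultimately show ?thesis
    using check_rows_subspace[OF card_field _ _ cert(2), of \<alpha> j] by (simp add: power_add)
qed

lemma bits_numeral:
  "bits Numeral1 = [True]"
  "bits (numeral (num.Bit0 m)) = False # bits (numeral m)"
  "bits (numeral (num.Bit1 m)) = True # bits (numeral m)"
  by (subst bits.simps, simp)+

lemma replicate_numeral: "replicate (numeral m) x = x # replicate (pred_numeral m) x"
  by (simp add: numeral_eq_Suc)

lemmas certificate_eval =
  certified_def splits_def check_rows.simps vanishes.simps bit_frac.simps frac_step.simps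
  reduce_all.simps iterate_square.simps mod_mult_def fold_down_def low_part.simps high_part.simps
  bit_mult.simps bit_add.simps is_zero.simps list.map append.simps
  bits_numeral replicate_numeral replicate_0 replicate_Suc pred_numeral_simps Num.BitM.simps
  simp_thms

text \<open>
The moduli \<open>X ^ n + r\<close> are irreducible. The rows come from a search: for the span \<open>W\<close> of all basis
vectors but \<open>v\<close>, the quotient formula makes a zero sum equivalent to \<open>L\<^sub>W(v) = a(W) / s(W)\<close>. This is a
linear system for \<open>v\<close>, solvable for roughly one \<open>c\<close> in \<open>2 ^ (k - 1)\<close>. Then \<open>i\<close> is the inverse of the
denominator that \<open>bit_frac\<close> computes.
\<close>

lemma certified_7:
  "certified 7 3
    [(24, 98, 25)]"
  by (simp only: certificate_eval)

lemma certified_9: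
  "certified 9 3
    [(2, 332, 423), (248, 364, 347)]"
  by (simp only: certificate_eval)

lemma certified_11:
  "certified 11 5
    [(24, 1838, 591), (36, 1416, 385), (152, 584, 1111)]"
  by (simp only: certificate_eval)

lemma certified_13:
  "certified 13 27
    [(6, 7546, 4368), (72, 1920, 3366), (344, 680, 3446), (176, 352, 1301)]"
  by (simp only: certificate_eval)

lemma certified_15:
  "certified 15 3
    [(2, 6060, 5734), (60, 18760, 21268), (8, 8672, 2966), (976, 25040, 26416),
     (480, 21600, 8347)]"
  by (simp only: certificate_eval)

lemma certified_17:
  "certified 17 9
    [(28, 45516, 94773), (16, 91976, 104949), (64, 103608, 36520), (624, 46528, 3632),
     (224, 32608, 60789), (2560, 119872, 59465)]"
  by (simp only: certificate_eval)

lemma certified_19: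
  "certified 19 39
    [(6, 235578, 212078), (36, 482500, 122997), (88, 348688, 199390),
     (640, 339424, 253338), (3648, 37952, 197680), (1152, 164736, 47977),
     (43008, 328192, 185913)]"
  by (simp only: certificate_eval)

lemma certified_21:
  "certified 21 5
    [(2, 606056, 1625295), (12, 1549780, 1082531), (128, 1671520, 332649),
     (608, 446864, 1351848), (608, 1342464, 333111), (5568, 1753984, 1595807),
     (3200, 1271552, 1518717), (59392, 1334016, 674936)]"
  by (simp only: certificate_eval)

lemma certified_23:
  "certified 23 33
    [(6, 8297896, 4829064), (8, 3512704, 1812296), (304, 2854984, 2537363),
     (912, 1923344, 3127297), (1888, 2744672, 4540991), (4864, 1745344, 5272937),
     (34816, 6383616, 66857), (356608, 3279872, 19940), (113152, 4226048, 1396822)]"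
  by (simp only: certificate_eval)

lemma certified_25:
  "certified 25 9
    [(2, 19905192, 31037854), (68, 8590336, 8090073), (32, 462280, 21532762),
     (128, 20845104, 17445883), (1088, 20493088, 33074021), (1984, 1699840, 28337302),
     (23680, 28226944, 31252241), (362496, 25231616, 11956642),
     (672256, 8783872, 10609177), (1331200, 7222272, 32083548)]"
  by (simp only: certificate_eval)

lemma certified_27:
  "certified 27 39
    [(24, 48778092, 67696768), (12, 44411268, 105801623), (24, 36087744, 70229831),
     (576, 200016, 98492847), (640, 132365664, 125458777), (768, 34770176, 132177576),
     (33792, 44108288, 66159330), (21760, 109840896, 97019984),
     (323072, 41066496, 8865677), (1870848, 52780032, 51476590),
     (7731200, 69707776, 83949754)]"
  by (simp only: certificate_eval)

lemma zero_sum_subspace_exists: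
  assumes card_field: "CARD('a::{field,finite}) = 2 ^ n"
    and "odd n" and "n \<le> 27" and "3 \<le> k" and "2 * k < n"
  shows "\<exists>V :: 'a set. binary_subspace V \<and> card V = 2 ^ k \<and> recip_sum V = 0"
proof -
  have "n \<in> {7, 9, 11, 13, 15, 17, 19, 21, 23, 25, 27}"
    using assms(2-5) by simp presburger
  \<comment> \<open>The table for \<open>n\<close> has a row for each \<open>k\<close> from \<open>3\<close> to \<open>(n - 1) / 2\<close>.\<close>
  moreover have ?thesis if "certified n r rows" and "n = 2 * length rows + 5" for r rows
    using certified_subspace[OF card_field that(1) assms(4)] assms(5) that(2) by simp
  ultimately show ?thesis
    using certified_7 certified_9 certified_11 certified_13 certified_15 certified_17
      certified_19 certified_21 certified_23 certified_25 certified_27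
    by (elim insertE emptyE) fastforce+
qed

text \<open>
Outside \<open>{1, 2, n - 2, n - 1}\<close>, either \<open>k\<close> or \<open>n - k\<close> lies in the range of the certificates, because
\<open>n\<close> is odd and \<open>2 * k \<noteq> n\<close>.
\<close>

theorem corollary5p6:
  fixes n :: nat
  assumes "odd n" and "3 \<le> n" and "n \<le> 27"
    and "CARD('a::{field,finite}) = 2 ^ n"
  shows "{k::nat. 1 \<le> k \<and> k \<le> n - 1 \<and> sum_free_of_order k (f_inv :: 'a \<Rightarrow> 'a)}
       = {1, 2, n - 2, n - 1}"
proof -
  let ?zero_sum = "\<lambda>k. \<exists>V :: 'a set. binary_subspace V \<and> card V = 2 ^ k \<and> recip_sum V = 0"
  note card_field = assms(4)
  have dual: "?zero_sum (n - k)" if "?zero_sum k" "k \<le> n" for k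
    using that dual_subspace[OF card_field] assms(2) by auto
  have small: "\<not> ?zero_sum 1" "\<not> ?zero_sum 2"
    using recip_sum_line_nonzero[OF card_field] recip_sum_plane_nonzero[OF card_field assms(1)]
    by auto
  have "\<not> ?zero_sum (n - 1)" "\<not> ?zero_sum (n - 2)"
    using small dual[of "n - 1"] dual[of "n - 2"] assms(2) by auto
  moreover have "?zero_sum k" if "3 \<le> k" "k + 3 \<le> n" for k
  proof (cases "2 * k < n")
    case True
    then show ?thesis
      using zero_sum_subspace_exists[OF card_field assms(1,3)] that by blast
  next
    case False
    moreover have "2 * k \<noteq> n" using assms(1) by auto
    ultimately have "2 * (n - k) < n" using assms(2) by arith
    then have "?zero_sum (n - k)"
      using zero_sum_subspace_exists[OF card_field assms(1,3)] that by auto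
    then show ?thesis
      using dual[of "n - k"] that by simp
  qed
  moreover have "k \<in> {1, 2, n - 2, n - 1} \<or> 3 \<le> k \<and> k + 3 \<le> n" if "1 \<le> k" "k \<le> n - 1" for k
    using that by auto
  moreover have "{1, 2, n - 2, n - 1} \<subseteq> {1..n - 1}"
    using assms(2) by auto
  ultimately have "1 \<le> k \<and> k \<le> n - 1 \<and> \<not> ?zero_sum k \<longleftrightarrow> k \<in> {1, 2, n - 2, n - 1}" for k
    using small by (smt (verit) atLeastAtMost_iff insertE insertI1 insertI2 singletonD subsetD)
  then show ?thesis
    unfolding sum_free_f_inv_iff[OF card_field] by blast
qed

end
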